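(* Let $n\ge 1$ and let $(V_i)_i$ be a finite family of matrices in $\mathbb{C}^{n\times n}$ with $\sum_i V_i^*V_i=I$. Define the Kraus map $\Psi(Z)=\sum_i V_i Z V_i^*$ and its dual map $\Phi(X)=\sum_i V_i^* X V_i$ on Hermitian $n\times n$ matrices. Assume that for some positive integer $N$ the $N$-th iterate $\Phi^N$ has finite projective diameter, $\Delta(\Phi^N)<\infty$. Then there exists a unique fixed point $\bar Z$ of $\Psi$ in $\mathcal{K}_1$, and for any $Z_0\in\mathcal{K}_1$ the solution of $Z(t+1)=\Psi(Z(t))$, $Z(0)=Z_0$, satisfies $\lim_{t\to+\infty}Z(t)=\bar Z$. For any Hermitian matrix $X_0\in\mathbb{C}^{n\times n}$, the solution of $X(t+1)=\Phi(X(t))$, $X(0)=X_0$, satisfies $\lim_{t\to+\infty}X(t)=\mathrm{tr}(\bar Z X_0)\,I$. Moreover, the convergence is exponential.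
   Context: $\mathcal{K}$ is the cone of positive semidefinite Hermitian matrices in $\mathbb{C}^{n\times n}$, $\mathrm{int}\,\mathcal{K}$ the set of positive definite Hermitian matrices, and $\mathcal{K}_1=\{X\in\mathcal{K} : \mathrm{tr}(X)=1\}$. $^*$ denotes conjugate transpose. Hilbert's (projective) metric on $\mathrm{int}\,\mathcal{K}$ is $$d(X,Y)=\log\frac{\lambda_{\max}(Y^{-1/2}XY^{-1/2})}{\lambda_{\min}(Y^{-1/2}XY^{-1/2})},$$ where $\lambda_{\max},\lambda_{\min}$ denote the largest and smallest eigenvalue. The map $\Phi$ (and each of its iterates) maps $\mathrm{int}\,\mathcal{K}$ into itself. The projective diameter of a map $A:\mathrm{int}\,\mathcal{K}\to\mathrm{int}\,\mathcal{K}$ is $\Delta(A)=\sup\{d(A(X),A(Y)) : X,Y\in\mathrm{int}\,\mathcal{K}\}\in[0,\infty]$. *)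

theory Defs
  imports "HOL-Analysis.Analysis"
begin

definition conj_transpose :: "complex^'n^'m \<Rightarrow> complex^'m^'n" where
  "conj_transpose A = (\<chi> i j. cnj (A $ j $ i))"

definition hermitian :: "complex^'n^'n \<Rightarrow> bool" where
  "hermitian A \<longleftrightarrow> conj_transpose A = A"

definition quad_form :: "complex^'n^'n \<Rightarrow> complex^'n \<Rightarrow> complex" where
  "quad_form A x = (\<Sum>i\<in>UNIV. cnj (x $ i) * (A *v x) $ i)"

text \<open>For Hermitian \<open>A\<close> the value \<open>quad_form A x\<close> is real, so taking real parts loses nothing.\<close>

definition psd_cone :: "(complex^'n^'n) set" where
  "psd_cone = {A. hermitian A \<and> (\<forall>x. 0 \<le> Re (quad_form A x))}"

definition pd_cone :: "(complex^'n^'n) set" where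
  "pd_cone = {A. hermitian A \<and> (\<forall>x. x \<noteq> 0 \<longrightarrow> 0 < Re (quad_form A x))}"

definition density_matrices :: "(complex^'n^'n) set" where
  "density_matrices = {A \<in> psd_cone. trace A = 1}"

text \<open>Only real eigenvalues are collected; the eigenvalues of a Hermitian matrix are all real.\<close>

definition real_eigenvalues :: "complex^'n^'n \<Rightarrow> real set" where
  "real_eigenvalues A = {l. \<exists>v. v \<noteq> 0 \<and> A *v v = complex_of_real l *s v}"

definition lambda_max :: "complex^'n^'n \<Rightarrow> real" where
  "lambda_max A = Max (real_eigenvalues A)"

definition lambda_min :: "complex^'n^'n \<Rightarrow> real" where
  "lambda_min A = Min (real_eigenvalues A)"

definition psd_sqrt :: "complex^'n^'n \<Rightarrow> complex^'n^'n" where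
  "psd_sqrt A = (THE B. B \<in> psd_cone \<and> B ** B = A)"

definition inv_sqrt :: "complex^'n^'n \<Rightarrow> complex^'n^'n" where
  "inv_sqrt A = matrix_inv (psd_sqrt A)"

definition hilbert_dist :: "complex^'n^'n \<Rightarrow> complex^'n^'n \<Rightarrow> real" where
  "hilbert_dist X Y =
     ln (lambda_max (inv_sqrt Y ** X ** inv_sqrt Y) / lambda_min (inv_sqrt Y ** X ** inv_sqrt Y))"

definition projective_diameter :: "(complex^'n^'n \<Rightarrow> complex^'n^'n) \<Rightarrow> ereal" where
  "projective_diameter A = (SUP (X, Y)\<in>pd_cone \<times> pd_cone. ereal (hilbert_dist (A X) (A Y)))"

definition kraus :: "'i set \<Rightarrow> ('i \<Rightarrow> complex^'n^'n) \<Rightarrow> complex^'n^'n \<Rightarrow> complex^'n^'n" where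
  "kraus J V Z = (\<Sum>i\<in>J. V i ** Z ** conj_transpose (V i))"

definition kraus_dual :: "'i set \<Rightarrow> ('i \<Rightarrow> complex^'n^'n) \<Rightarrow> complex^'n^'n \<Rightarrow> complex^'n^'n" where
  "kraus_dual J V X = (\<Sum>i\<in>J. conj_transpose (V i) ** X ** V i)"

end

theory Submission
  imports Defs
begin

text \<open>Comparing \<open>\<Phi>\<^sup>N X\<close> with \<open>\<Phi>\<^sup>N I = I\<close> in Hilbert's metric, a finite projective diameter
  bounds the ratio of the extreme eigenvalues of \<open>\<Phi>\<^sup>N X\<close> by a constant \<open>K\<close>, uniformly in the
  positive definite \<open>X\<close>. Applied to \<open>X - a I\<close> and \<open>b I - X\<close>, where \<open>a I \<le> X \<le> b I\<close>, this shrinks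
  the width \<open>b - a\<close> of the spectrum by the factor \<open>(K - 1) / (K + 1)\<close>, so \<open>\<Phi>\<^sup>t X\<close> approaches the
  scalar matrices exponentially. By duality \<open>\<Psi>\<^sup>t\<close> decays exponentially on traceless Hermitian
  matrices, which makes every orbit of density matrices Cauchy, and its limit is the fixed point.
  The scalar limit of \<open>\<Phi>\<^sup>t X\<close> is identified by the invariant pairing with that fixed point.\<close>

section \<open>Self-adjoint operators\<close>

text \<open>A zero of a nonnegative quadratic form is a minimum, so the gradient
  \<open>2 f v\<close> vanishes there: otherwise moving from \<open>v\<close> against
  \<open>f v\<close> would make the form negative.\<close>

lemma selfadjoint_form_kernel:
  fixes f :: "'a::real_inner \<Rightarrow> 'a"
  assumes lin: "linear f" and sa: "\<And>x y. f x \<bullet> y = x \<bullet> f y"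
    and nonneg: "\<And>x. 0 \<le> x \<bullet> f x" and zero: "v \<bullet> f v = 0"
  shows "f v = 0"
proof (rule ccontr)
  assume "f v \<noteq> 0"
  define p where "p = f v \<bullet> f v"
  define q where "q = f v \<bullet> f (f v)"
  \<comment> \<open>The form at \<open>v + t f v\<close> is \<open>2 t p + t^2 q\<close>, which this
    negative \<open>t\<close> makes negative; the \<open>+ 1\<close> keeps the denominator positive
    when \<open>q = 0\<close>.\<close>
  define t where "t = - p / (q + 1)"
  have "p > 0" "q \<ge> 0"
    using \<open>f v \<noteq> 0\<close> nonneg by (auto simp: p_def q_def)
  have "p = - t * (q + 1)"
    using \<open>q \<ge> 0\<close> by (simp add: t_def)
  have "0 \<le> (v + t *\<^sub>R f v) \<bullet> f (v + t *\<^sub>R f v)"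
    by (rule nonneg)
  also have "\<dots> = 2 * t * p + t\<^sup>2 * q"
    using zero sa[of v "f v"]
    by (simp add: linear_add[OF lin] linear_scale[OF lin] inner_add p_def q_def power2_eq_square algebra_simps)
  also have "\<dots> = - t\<^sup>2 * (q + 2)"
    unfolding \<open>p = - t * (q + 1)\<close> by (simp add: algebra_simps power2_eq_square)
  also have "\<dots> < 0"
    using \<open>p > 0\<close> \<open>q \<ge> 0\<close> by (simp add: t_def)
  finally show False by simp
qed

text \<open>The Rayleigh quotient has a maximiser \<open>v\<close> on the compact unit sphere. The
  form of \<open>(v \<bullet> f v) I - f\<close> is nonnegative and vanishes at \<open>v\<close>, so
  \<open>v\<close> lies in its kernel and is an eigenvector.\<close>

lemma selfadjoint_attains_max:
  fixes f :: "'a::euclidean_space \<Rightarrow> 'a"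
  assumes lin: "linear f" and sa: "\<And>x y. f x \<bullet> y = x \<bullet> f y"
  obtains v where "norm v = 1" "f v = (v \<bullet> f v) *\<^sub>R v"
    "\<And>x. x \<bullet> f x \<le> (v \<bullet> f v) * (x \<bullet> x)"
proof -
  have "continuous_on (sphere 0 1) (\<lambda>x. x \<bullet> f x)"
    using lin by (intro continuous_intros linear_continuous_on) (simp add: linear_conv_bounded_linear)
  then obtain v where v: "v \<in> sphere 0 1" "\<And>x. x \<in> sphere 0 1 \<Longrightarrow> x \<bullet> f x \<le> v \<bullet> f v"
    using continuous_attains_sup[of "sphere (0::'a) 1" "\<lambda>x. x \<bullet> f x"] by auto
  have max: "x \<bullet> f x \<le> (v \<bullet> f v) * (x \<bullet> x)" for x
  proof (cases "x = 0")
    case False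
    let ?y = "x /\<^sub>R norm x"
    have "x \<bullet> f x = (?y \<bullet> f ?y) * (x \<bullet> x)"
      using False by (simp add: linear_scale[OF lin] dot_square_norm power2_eq_square field_simps)
    also have "\<dots> \<le> (v \<bullet> f v) * (x \<bullet> x)"
      using v(2)[of ?y] False by (intro mult_right_mono) auto
    finally show ?thesis .
  qed (simp add: linear_0[OF lin])
  define g where "g x = (v \<bullet> f v) *\<^sub>R x - f x" for x
  have "g v = 0"
  proof (rule selfadjoint_form_kernel[of g])
    show "linear g"
      unfolding g_def by (intro linear_compose_sub linear_compose_scale_right linear_id lin)
        (simp_all add: linear_iff)
    show "v \<bullet> g v = 0"
      using v(1) by (simp add: g_def inner_diff dot_square_norm)
  qed (use sa max in \<open>simp_all add: g_def inner_diff\<close>)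
  with v(1) max that show ?thesis by (simp add: g_def)
qed

lemma selfadjoint_attains_min:
  fixes f :: "'a::euclidean_space \<Rightarrow> 'a"
  assumes lin: "linear f" and sa: "\<And>x y. f x \<bullet> y = x \<bullet> f y"
  obtains v where "norm v = 1" "f v = (v \<bullet> f v) *\<^sub>R v"
    "\<And>x. (v \<bullet> f v) * (x \<bullet> x) \<le> x \<bullet> f x"
proof -
  obtain v where "norm v = 1" "- f v = (v \<bullet> - f v) *\<^sub>R v"
    "\<And>x. x \<bullet> - f x \<le> (v \<bullet> - f v) * (x \<bullet> x)"
    using selfadjoint_attains_max[of "\<lambda>x. - f x"] lin sa
    by (auto simp: linear_compose_neg)
  then show ?thesis using that by simp
qed

text \<open>Eigenvectors for distinct eigenvalues are orthogonal, and a Euclidean space holds only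
  finitely many nonzero pairwise orthogonal vectors. Finiteness gives \<open>Max\<close> and
  \<open>Min\<close> in \<open>lambda_max\<close> and \<open>lambda_min\<close> their
  meaning.\<close>

lemma finite_selfadjoint_eigenvalues:
  fixes f :: "'a::euclidean_space \<Rightarrow> 'a"
  assumes sa: "\<And>x y. f x \<bullet> y = x \<bullet> f y"
  shows "finite {l. \<exists>v. v \<noteq> 0 \<and> f v = l *\<^sub>R v}"
proof -
  let ?E = "{l. \<exists>v. v \<noteq> 0 \<and> f v = l *\<^sub>R v}"
  have "\<exists>e. \<forall>l\<in>?E. e l \<noteq> 0 \<and> f (e l) = l *\<^sub>R e l"
    by (rule bchoice) auto
  then obtain e where e: "\<And>l. l \<in> ?E \<Longrightarrow> e l \<noteq> 0 \<and> f (e l) = l *\<^sub>R e l"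
    by blast
  have orth: "e l \<bullet> e m = 0" if "l \<in> ?E" "m \<in> ?E" "l \<noteq> m" for l m
  proof -
    have "l * (e l \<bullet> e m) = m * (e l \<bullet> e m)"
      using sa[of "e l" "e m"] e[OF that(1)] e[OF that(2)] by simp
    then show ?thesis using that(3) by simp
  qed
  have "inj_on e ?E"
  proof (rule inj_onI, rule ccontr)
    fix l m assume "l \<in> ?E" "m \<in> ?E" "e l = e m" "l \<noteq> m"
    then show False using orth[of l m] e[of l] by auto
  qed
  moreover have "pairwise orthogonal (e ` ?E)"
    using orth unfolding pairwise_def orthogonal_def by blast
  then have "finite (e ` ?E)"
    using pairwise_orthogonal_imp_finite by blast
  ultimately show ?thesis
    using finite_imageD by blast
qed

section \<open>Hermitian matrices\<close>

lemma conj_transpose_nth [simp]: "conj_transpose A $ i $ j = cnj (A $ j $ i)"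
  by (simp add: conj_transpose_def)

lemma conj_transpose_simps [simp]:
  "conj_transpose (conj_transpose A) = A"
  "conj_transpose (A + B) = conj_transpose A + conj_transpose B"
  "conj_transpose (A - B) = conj_transpose A - conj_transpose B"
  "conj_transpose (r *\<^sub>R A) = r *\<^sub>R conj_transpose A"
  "conj_transpose 0 = 0"
  "conj_transpose (mat 1) = mat 1"
  by (simp_all add: vec_eq_iff mat_def)

lemma conj_transpose_mult: "conj_transpose (A ** B) = conj_transpose B ** conj_transpose A"
  by (simp add: vec_eq_iff matrix_matrix_mult_def mult.commute)

lemma conj_transpose_sum: "conj_transpose (sum F J) = (\<Sum>i\<in>J. conj_transpose (F i))"
  by (induction J rule: infinite_finite_induct) auto

lemma hermitian_simps [simp]:
  "hermitian (mat 1)"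
  "hermitian A \<Longrightarrow> hermitian B \<Longrightarrow> hermitian (A + B)"
  "hermitian A \<Longrightarrow> hermitian B \<Longrightarrow> hermitian (A - B)"
  "hermitian A \<Longrightarrow> hermitian (r *\<^sub>R A)"
  by (simp_all add: hermitian_def)

section \<open>Real inner products of complex vectors and matrices\<close>

lemma inner_complex_vec: "(x :: complex^'n) \<bullet> y = Re (\<Sum>i\<in>UNIV. cnj (x $ i) * y $ i)"
  by (simp add: inner_vec_def inner_complex_def)

text \<open>The Euclidean inner product on matrices is the real part of the Hilbert-Schmidt pairing,
  so trace duality becomes adjointness.\<close>

lemma inner_complex_matrix: "(A :: complex^'n^'m) \<bullet> B = Re (trace (conj_transpose A ** B))"
  unfolding inner_vec_def[of A] inner_complex_vec trace_def matrix_matrix_mult_def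
  by (simp, rule sum.swap)

lemma inner_matrix_mult_left: "((A :: complex^'n^'m) ** B) \<bullet> C = B \<bullet> (conj_transpose A ** C)"
  by (simp add: inner_complex_matrix conj_transpose_mult matrix_mul_assoc)

lemma inner_matrix_mult_right: "((A :: complex^'n^'m) ** B) \<bullet> C = A \<bullet> (C ** conj_transpose B)"
  using trace_mul_sym[of "conj_transpose B" "conj_transpose A ** C"]
  by (simp add: inner_complex_matrix conj_transpose_mult matrix_mul_assoc)

lemma inner_mat_1: "(A :: complex^'n^'n) \<bullet> mat 1 = Re (trace A)"
  by (simp add: inner_complex_matrix trace_def)

lemma Re_quad_form: "Re (quad_form A x) = x \<bullet> (A *v x)"
  by (simp add: quad_form_def inner_complex_vec)

text \<open>Adjointness survives the passage to the real inner product, so Hermitian matrices act as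
  self-adjoint operators on a real Euclidean space.\<close>

lemma inner_conj_transpose: "(conj_transpose A *v x) \<bullet> y = x \<bullet> (A *v y)"
proof -
  have "(\<Sum>i\<in>UNIV. cnj ((conj_transpose A *v x) $ i) * y $ i)
      = (\<Sum>i\<in>UNIV. \<Sum>j\<in>UNIV. cnj (x $ j) * A $ j $ i * y $ i)"
    by (simp add: matrix_vector_mult_def sum_distrib_left sum_distrib_right ac_simps)
  also have "\<dots> = (\<Sum>j\<in>UNIV. cnj (x $ j) * (A *v y) $ j)"
    by (subst sum.swap) (simp add: matrix_vector_mult_def sum_distrib_left ac_simps)
  finally show ?thesis by (simp add: inner_complex_vec)
qed

lemma hermitian_inner: "hermitian A \<Longrightarrow> (A *v x) \<bullet> y = x \<bullet> (A *v y)"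
  using inner_conj_transpose[of A x y] by (simp add: hermitian_def)

lemma matrix_vector_mult_scaleR_left: "(r *\<^sub>R A) *v (x :: complex^'n) = r *\<^sub>R (A *v x)"
  by (simp add: vec_eq_iff matrix_vector_mult_def scaleR_sum_right)

lemma linear_matrix_vector: "linear (\<lambda>x :: complex^'n. A *v x)"
  by (rule linearI)
    (simp_all add: vec_eq_iff matrix_vector_mult_def scaleR_sum_right algebra_simps sum.distrib)

lemma real_eigenvalues_eq:
  "real_eigenvalues (A :: complex^'n^'n) = {l. \<exists>v. v \<noteq> 0 \<and> A *v v = l *\<^sub>R v}"
proof -
  have "complex_of_real l *s v = l *\<^sub>R v" for l and v :: "complex^'n"
    by (simp add: vec_eq_iff scaleR_conv_of_real[where 'a = complex])
  then show ?thesis by (simp add: real_eigenvalues_def)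
qed

text \<open>The extremal Rayleigh values are themselves real eigenvalues, so the finite set of
  eigenvalues is nonempty and its extremes bound the form.\<close>

lemma eigenvalue_bounds:
  fixes A :: "complex^'n^'n"
  assumes "hermitian A"
  shows "lambda_min A \<in> real_eigenvalues A" "lambda_max A \<in> real_eigenvalues A"
    "lambda_min A * (x \<bullet> x) \<le> x \<bullet> (A *v x)" "x \<bullet> (A *v x) \<le> lambda_max A * (x \<bullet> x)"
proof -
  note sa = hermitian_inner[OF assms]
  have fin: "finite (real_eigenvalues A)"
    unfolding real_eigenvalues_eq by (rule finite_selfadjoint_eigenvalues) (rule sa)
  obtain v where v: "norm v = 1" "A *v v = (v \<bullet> (A *v v)) *\<^sub>R v"
    "\<And>x. x \<bullet> (A *v x) \<le> (v \<bullet> (A *v v)) * (x \<bullet> x)"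
    using selfadjoint_attains_max[OF linear_matrix_vector sa] by blast
  obtain w where w: "norm w = 1" "A *v w = (w \<bullet> (A *v w)) *\<^sub>R w"
    "\<And>x. (w \<bullet> (A *v w)) * (x \<bullet> x) \<le> x \<bullet> (A *v x)"
    using selfadjoint_attains_min[OF linear_matrix_vector sa] by blast
  have mem: "v \<bullet> (A *v v) \<in> real_eigenvalues A" "w \<bullet> (A *v w) \<in> real_eigenvalues A"
  proof -
    have "v \<noteq> 0" "w \<noteq> 0"
      using v(1) w(1) by auto
    with v(2) w(2) show "v \<bullet> (A *v v) \<in> real_eigenvalues A" "w \<bullet> (A *v w) \<in> real_eigenvalues A"
      unfolding real_eigenvalues_eq by blast+
  qed
  then show "lambda_min A \<in> real_eigenvalues A" "lambda_max A \<in> real_eigenvalues A"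
    using fin Min_in[of "real_eigenvalues A"] Max_in[of "real_eigenvalues A"]
    unfolding lambda_min_def lambda_max_def by blast+
  have "v \<bullet> (A *v v) \<le> lambda_max A" "lambda_min A \<le> w \<bullet> (A *v w)"
    using fin mem unfolding lambda_min_def lambda_max_def by simp_all
  then show "lambda_min A * (x \<bullet> x) \<le> x \<bullet> (A *v x)" "x \<bullet> (A *v x) \<le> lambda_max A * (x \<bullet> x)"
    using v(3)[of x] w(3)[of x] by (meson inner_ge_zero mult_right_mono order_trans)+
qed

section \<open>Positive definite matrices and the Hilbert distance to the identity\<close>

lemma pd_eigenvalue_pos:
  assumes "A \<in> pd_cone" "l \<in> real_eigenvalues A"
  shows "0 < l"
proof -
  obtain v where "v \<noteq> 0" "A *v v = l *\<^sub>R v"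
    using assms(2) by (auto simp: real_eigenvalues_eq)
  moreover have "0 < v \<bullet> (A *v v)"
    using assms(1) \<open>v \<noteq> 0\<close> by (simp add: pd_cone_def Re_quad_form)
  ultimately have "0 < l * (v \<bullet> v)" by simp
  then show ?thesis
    using \<open>v \<noteq> 0\<close> zero_less_mult_pos2[of l "v \<bullet> v"] by simp
qed

lemma mat_1_pd [simp]: "mat 1 \<in> pd_cone"
  by (simp add: pd_cone_def Re_quad_form)

text \<open>Evaluates the definite description in \<open>psd_sqrt\<close> at the identity. If
  \<open>B ** B = mat 1\<close>, then \<open>B *v x - x\<close> lies in the eigenspace of
  \<open>B\<close> for -1, which is trivial when \<open>B\<close> is positive semidefinite.\<close>

lemma inv_sqrt_mat_1: "inv_sqrt (mat 1 :: complex^'n^'n) = mat 1"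
proof -
  have "B = mat 1" if B: "B \<in> psd_cone" "B ** B = mat 1" for B :: "complex^'n^'n"
  proof -
    have "B *v x = x" for x
    proof -
      define y where "y = B *v x - x"
      have "B *v y = - y"
        using B(2) by (simp add: y_def matrix_vector_mult_diff_distrib matrix_vector_mul_assoc)
      moreover have "0 \<le> y \<bullet> (B *v y)"
        using B(1) by (simp add: psd_cone_def Re_quad_form)
      ultimately have "y \<bullet> y \<le> 0" by simp
      then have "y = 0" using inner_gt_zero_iff[of y] by linarith
      then show ?thesis by (simp add: y_def)
    qed
    then show ?thesis by (simp add: matrix_eq)
  qed
  then have "psd_sqrt (mat 1 :: complex^'n^'n) = mat 1"
    unfolding psd_sqrt_def by (intro the_equality) (auto simp: psd_cone_def Re_quad_form)
  then show ?thesis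
    by (simp add: inv_sqrt_def matrix_inv_def)
qed

lemma hilbert_dist_mat_1: "hilbert_dist A (mat 1) = ln (lambda_max A / lambda_min A)"
  by (simp add: hilbert_dist_def inv_sqrt_mat_1)

lemma psd_cone_iff: "A \<in> psd_cone \<longleftrightarrow> hermitian A \<and> (\<forall>x. 0 \<le> x \<bullet> (A *v x))"
  by (simp add: psd_cone_def Re_quad_form)

lemma pd_cone_iff: "A \<in> pd_cone \<longleftrightarrow> hermitian A \<and> (\<forall>x. x \<noteq> 0 \<longrightarrow> 0 < x \<bullet> (A *v x))"
  by (simp add: pd_cone_def Re_quad_form)

section \<open>Traces and density matrices\<close>

lemma trace_conj_transpose: "trace (conj_transpose A) = cnj (trace A)"
  by (simp add: trace_def)

lemma hermitian_trace: "hermitian A \<Longrightarrow> trace A = of_real (A \<bullet> mat 1)"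
  using trace_conj_transpose[of A] by (simp add: hermitian_def inner_mat_1 complex_eq_iff)

text \<open>Conjugate transposition reverses the product and the trace is cyclic, so this trace is
  real.\<close>

lemma hermitian_trace_mult:
  assumes "hermitian A" "hermitian B"
  shows "trace (A ** B) = of_real (A \<bullet> B)"
proof -
  have "cnj (trace (A ** B)) = trace (A ** B)"
    using assms by (metis conj_transpose_mult hermitian_def trace_conj_transpose trace_mul_sym)
  moreover have "Re (trace (A ** B)) = A \<bullet> B"
    using assms(1) by (simp add: inner_complex_matrix hermitian_def)
  ultimately show ?thesis
    by (metis Reals_cnj_iff of_real_Re)
qed

lemma density_matrices_iff: "A \<in> density_matrices \<longleftrightarrow> A \<in> psd_cone \<and> A \<bullet> mat 1 = 1"
  by (auto simp: density_matrices_def psd_cone_iff hermitian_trace)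

lemma mat_of_real: "mat (complex_of_real c) = c *\<^sub>R mat 1"
  by (simp add: vec_eq_iff mat_def scaleR_conv_of_real[where 'a = complex])

text \<open>Each defining condition is closed, being stated through continuous maps; hence a limit
  of density matrices is again one.\<close>

lemma closed_density_matrices: "closed (density_matrices :: (complex^'n^'n) set)"
proof -
  have "linear (conj_transpose :: complex^'n^'n \<Rightarrow> complex^'n^'n)"
    by (rule linearI) simp_all
  moreover have "linear (\<lambda>A :: complex^'n^'n. A *v x)" for x
    by (rule linearI) (simp_all add: matrix_vector_mult_add_rdistrib matrix_vector_mult_scaleR_left)
  ultimately have [continuous_intros]:
      "continuous_on UNIV (conj_transpose :: complex^'n^'n \<Rightarrow> complex^'n^'n)"
      "continuous_on UNIV (\<lambda>A :: complex^'n^'n. A *v x)" for x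
    by (simp_all add: linear_continuous_on linear_conv_bounded_linear)
  have eq: "density_matrices = {A :: complex^'n^'n. conj_transpose A = A} \<inter>
      (\<Inter>x. {A. 0 \<le> x \<bullet> (A *v x)}) \<inter> {A. A \<bullet> mat 1 = 1}"
    by (auto simp: density_matrices_iff psd_cone_iff hermitian_def)
  show ?thesis
    unfolding eq by (intro ballI closed_Int closed_INT closed_Collect_eq closed_Collect_le continuous_intros)
qed

section \<open>Bounds on Hermitian forms\<close>

text \<open>For Hermitian \<open>A\<close> this is the Loewner order enclosure
  \<open>a I \<le> A \<le> b I\<close>, and \<open>b - a\<close> bounds the width of the
  spectrum.\<close>

definition form_bounds :: "real \<Rightarrow> real \<Rightarrow> complex^'n^'n \<Rightarrow> bool" where
  "form_bounds a b A \<longleftrightarrow> (\<forall>x. a * (x \<bullet> x) \<le> x \<bullet> (A *v x) \<and> x \<bullet> (A *v x) \<le> b * (x \<bullet> x))"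

lemma form_bounds_add_scalar:
  "form_bounds a b A \<Longrightarrow> form_bounds (a + c) (b + c) (A + c *\<^sub>R mat 1)"
  by (simp add: form_bounds_def matrix_vector_mult_add_rdistrib matrix_vector_mult_scaleR_left
      algebra_simps inner_add)

lemma norm_le_sum_nth: "norm x \<le> (\<Sum>i\<in>UNIV. norm (x $ i))"
  unfolding norm_vec_def by (rule L2_set_le_sum) simp

lemma norm_matrix_le_sum: "norm (A :: complex^'n^'m) \<le> (\<Sum>i\<in>UNIV. \<Sum>j\<in>UNIV. norm (A $ i $ j))"
  by (rule order_trans[OF norm_le_sum_nth]) (intro sum_mono norm_le_sum_nth)

lemma norm_matrix_vector_le:
  "norm ((A :: complex^'n^'n) *v x) \<le> (real CARD('n))\<^sup>2 * norm A * norm x"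
proof -
  have "norm (A *v x) \<le> (\<Sum>i\<in>UNIV. norm ((A *v x) $ i))"
    by (rule norm_le_sum_nth)
  also have "\<dots> \<le> (\<Sum>i\<in>(UNIV :: 'n set). \<Sum>j\<in>(UNIV :: 'n set). norm A * norm x)"
  proof (rule sum_mono)
    fix i
    have "norm ((A *v x) $ i) \<le> (\<Sum>j\<in>UNIV. norm (A $ i $ j) * norm (x $ j))"
      unfolding matrix_vector_mult_def by (simp add: norm_mult[symmetric] norm_sum)
    also have "\<dots> \<le> (\<Sum>j\<in>(UNIV :: 'n set). norm A * norm x)"
      by (intro sum_mono mult_mono) (meson Finite_Cartesian_Product.norm_nth_le order_trans norm_ge_zero)+
    finally show "norm ((A *v x) $ i) \<le> (\<Sum>j\<in>(UNIV :: 'n set). norm A * norm x)" .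
  qed
  finally show ?thesis by (simp add: power2_eq_square mult.assoc)
qed

text \<open>Supplies a first enclosure whose width is proportional to the norm.\<close>

lemma form_bounds_norm:
  fixes A :: "complex^'n^'n"
  defines "c \<equiv> (real CARD('n))\<^sup>2 * norm A"
  shows "form_bounds (- c) c A"
proof -
  have "\<bar>x \<bullet> (A *v x)\<bar> \<le> c * (x \<bullet> x)" for x
  proof -
    have "\<bar>x \<bullet> (A *v x)\<bar> \<le> norm x * norm (A *v x)"
      by (rule Cauchy_Schwarz_ineq2)
    also have "\<dots> \<le> norm x * (c * norm x)"
      unfolding c_def by (intro mult_left_mono norm_matrix_vector_le) simp
    finally show ?thesis by (simp add: dot_square_norm power2_eq_square ac_simps)
  qed
  then show ?thesis
    by (simp add: form_bounds_def abs_le_iff minus_le_iff)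
qed

text \<open>By polarization, four times the left side is a difference of two form values. Both lie
  between 0 and \<open>4 * d\<close>, since \<open>x + y\<close> and \<open>x - y\<close> have norm
  at most 2.\<close>

lemma hermitian_polarization:
  assumes "hermitian A" "form_bounds 0 d A" "norm x = 1" "norm y = 1"
  shows "\<bar>x \<bullet> (A *v y)\<bar> \<le> d"
proof -
  let ?q = "\<lambda>z. z \<bullet> (A *v z)"
  have q: "0 \<le> ?q z" "?q z \<le> d * (z \<bullet> z)" for z
    using assms(2) by (auto simp: form_bounds_def)
  have "0 \<le> d"
    using q[of x] assms(3) by (simp add: dot_square_norm)
  have le: "?q z \<le> 4 * d" if "norm z \<le> 2" for z
  proof -
    have "z \<bullet> z \<le> 2\<^sup>2"
      using that unfolding dot_square_norm by (intro power_mono) auto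
    then show ?thesis
      using q(2)[of z] mult_left_mono[OF _ \<open>0 \<le> d\<close>, of "z \<bullet> z" 4] by simp
  qed
  have "?q (x + y) \<le> 4 * d" "?q (x - y) \<le> 4 * d"
    using le norm_triangle_ineq[of x y] norm_triangle_ineq4[of x y] assms(3,4) by simp_all
  moreover have "4 * (x \<bullet> (A *v y)) = ?q (x + y) - ?q (x - y)"
    using hermitian_inner[OF assms(1), of x y]
    by (simp add: matrix_vector_right_distrib matrix_vector_mult_diff_distrib inner_add inner_diff
        inner_commute algebra_simps)
  ultimately show ?thesis
    using q(1)[of "x + y"] q(1)[of "x - y"] by linarith
qed

lemma inner_axis_matrix_axis:
  "axis i 1 \<bullet> ((A :: complex^'n^'m) *v axis j z) = Re (A $ i $ j * z)"
proof -
  have "(A *v axis j z) $ i = A $ i $ j * z"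
    by (simp add: matrix_vector_mult_def axis_def if_distrib cong: if_cong)
  then show ?thesis
    by (simp add: inner_axis' inner_complex_def)
qed

text \<open>Turns a narrow enclosure into closeness to a scalar matrix. After the shift by
  \<open>a\<close>, polarization at coordinate vectors bounds every entry; the 2 comes from real and
  imaginary parts, the square from the number of entries.\<close>

lemma form_bounds_norm_diff_scalar:
  fixes A :: "complex^'n^'n" and a b :: real
  assumes "hermitian A" "form_bounds a b A"
  shows "norm (A - a *\<^sub>R mat 1) \<le> 2 * (real CARD('n))\<^sup>2 * (b - a)"
proof -
  define B where "B = A - a *\<^sub>R mat 1"
  have B: "hermitian B" "form_bounds 0 (b - a) B"
    using assms form_bounds_add_scalar[of a b A "- a"] by (simp_all add: B_def)
  have "norm (B $ i $ j) \<le> 2 * (b - a)" for i j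
  proof -
    note pol = hermitian_polarization[OF B, of "axis i 1"]
    have "\<bar>Re (B $ i $ j)\<bar> \<le> b - a"
      using pol[of "axis j 1"] by (simp add: inner_axis_matrix_axis)
    moreover have "\<bar>Im (B $ i $ j)\<bar> \<le> b - a"
      \<comment> \<open>Multiplying an entry by \<open>- \<i>\<close> turns its imaginary part into
        the real part.\<close>
      using pol[of "axis j (- \<i>)"]
      by (simp add: inner_axis_matrix_axis norm_eq_1[of "axis j (- \<i>)"] inner_axis_axis inner_complex_def)
    ultimately have "\<bar>Re (B $ i $ j)\<bar> + \<bar>Im (B $ i $ j)\<bar> \<le> 2 * (b - a)"
      by simp
    with cmod_le show ?thesis by (rule order_trans)
  qed
  then have "(\<Sum>i\<in>UNIV. \<Sum>j\<in>UNIV. norm (B $ i $ j)) \<le> (\<Sum>i\<in>(UNIV::'n set). \<Sum>j\<in>(UNIV::'n set). 2 * (b - a))"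
    by (intro sum_mono)
  with norm_matrix_le_sum[of B] show ?thesis
    by (simp add: B_def power2_eq_square algebra_simps)
qed

section \<open>Oscillation contracts under a positive unital map\<close>

text \<open>Apply the comparison hypothesis to the two positive semidefinite matrices
  \<open>A - a I\<close> and \<open>b I - A\<close> at unit vectors where the form of \<open>T A\<close> is extremal, and add the
  resulting inequalities.\<close>

lemma oscillation_contraction:
  fixes T :: "complex^'n^'n \<Rightarrow> complex^'n^'n"
  assumes lin: "linear T" and unital: "T (mat 1) = mat 1"
    and herm: "\<And>A. hermitian A \<Longrightarrow> hermitian (T A)"
    and "1 \<le> K"
    and comparison: "\<And>A v w. A \<in> psd_cone \<Longrightarrow> norm v = 1 \<Longrightarrow> norm w = 1 \<Longrightarrow>
      v \<bullet> (T A *v v) \<le> K * (w \<bullet> (T A *v w))"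
    and A: "hermitian A" "form_bounds a b A"
  obtains a' b' where "form_bounds a' b' (T A)" "b' - a' \<le> (K - 1) / (K + 1) * (b - a)"
proof -
  note sa = hermitian_inner[OF herm[OF A(1)]]
  obtain v where v: "norm v = 1" "\<And>x. x \<bullet> (T A *v x) \<le> (v \<bullet> (T A *v v)) * (x \<bullet> x)"
    using selfadjoint_attains_max[OF linear_matrix_vector sa] by blast
  obtain w where w: "norm w = 1" "\<And>x. (w \<bullet> (T A *v w)) * (x \<bullet> x) \<le> x \<bullet> (T A *v x)"
    using selfadjoint_attains_min[OF linear_matrix_vector sa] by blast
  let ?u = "v \<bullet> (T A *v v)" and ?l = "w \<bullet> (T A *v w)"
  let ?P = "A - a *\<^sub>R mat 1" and ?Q = "b *\<^sub>R mat 1 - A"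
  have P: "?P \<in> psd_cone" "?Q \<in> psd_cone"
    using A by (auto simp: psd_cone_iff form_bounds_def matrix_vector_mult_diff_rdistrib
        matrix_vector_mult_scaleR_left inner_diff)
  have "T ?P = T A - a *\<^sub>R mat 1" "T ?Q = b *\<^sub>R mat 1 - T A"
    by (simp_all add: linear_diff[OF lin] linear_scale[OF lin] unital)
  then have TP: "x \<bullet> (T ?P *v x) = x \<bullet> (T A *v x) - a" "x \<bullet> (T ?Q *v x) = b - x \<bullet> (T A *v x)"
    if "norm x = 1" for x
    using that by (simp_all add: matrix_vector_mult_diff_rdistrib
        matrix_vector_mult_scaleR_left inner_diff dot_square_norm)
  \<comment> \<open>For \<open>?Q\<close> the vectors swap roles: the form of \<open>T ?Q\<close> is
    largest where that of \<open>T A\<close> is smallest.\<close>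
  have "?u - a \<le> K * (?l - a)" "b - ?l \<le> K * (b - ?u)"
    using comparison[OF P(1) v(1) w(1)] comparison[OF P(2) w(1) v(1)] v(1) w(1) by (simp_all add: TP)
  then have "(?u - ?l) * (K + 1) \<le> (K - 1) * (b - a)"
    by (simp add: algebra_simps)
  then have "?u - ?l \<le> (K - 1) / (K + 1) * (b - a)"
    using \<open>1 \<le> K\<close> by (simp add: field_simps)
  moreover have "form_bounds ?l ?u (T A)"
    using v(2) w(2) by (simp add: form_bounds_def)
  ultimately show ?thesis using that by blast
qed

section \<open>Kraus maps\<close>

lemma linear_funpow:
  fixes f :: "'a::real_vector \<Rightarrow> 'a"
  assumes "linear f"
  shows "linear (f ^^ t)"
proof (induction t)
  case (Suc t)
  then show ?case
    using linear_compose[OF Suc assms] by (simp add: o_def)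
qed (simp add: linear_iff)

lemma kraus_dual_conv_kraus: "kraus_dual J V = kraus J (\<lambda>i. conj_transpose (V i))"
  by (simp add: kraus_dual_def kraus_def fun_eq_iff)

lemma linear_kraus: "linear (kraus J V :: complex^'n^'n \<Rightarrow> complex^'n^'n)"
proof (rule linearI)
  have *: "A ** (r *\<^sub>R B) ** C = r *\<^sub>R (A ** B ** C)" for r and A B C :: "complex^'n^'n"
    by (simp add: vec_eq_iff matrix_matrix_mult_def scaleR_sum_right sum_distrib_left sum_distrib_right)
  have add: "(A + B) ** C = A ** C + B ** C" for A B C :: "complex^'n^'n"
    by (simp add: vec_eq_iff matrix_matrix_mult_def sum.distrib distrib_right)
  show "kraus J V (A + B) = kraus J V A + kraus J V B" for A B
    by (simp add: kraus_def matrix_add_ldistrib add sum.distrib)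
  show "kraus J V (r *\<^sub>R A) = r *\<^sub>R kraus J V A" for r A
    by (simp add: kraus_def * scaleR_sum_right)
qed

lemma linear_kraus_dual: "linear (kraus_dual J V :: complex^'n^'n \<Rightarrow> complex^'n^'n)"
  by (simp add: kraus_dual_conv_kraus linear_kraus)

lemma hermitian_kraus: "hermitian Z \<Longrightarrow> hermitian (kraus J V Z)"
  by (simp add: hermitian_def kraus_def conj_transpose_sum conj_transpose_mult matrix_mul_assoc)

lemma hermitian_kraus_dual: "hermitian X \<Longrightarrow> hermitian (kraus_dual J V X)"
  by (simp add: kraus_dual_conv_kraus hermitian_kraus)

text \<open>Makes the two maps adjoint to each other, so estimates on one transfer to the
  other.\<close>

lemma inner_kraus: "kraus J V Z \<bullet> X = Z \<bullet> kraus_dual J V X"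
proof -
  have "(V i ** Z ** conj_transpose (V i)) \<bullet> X = Z \<bullet> (conj_transpose (V i) ** X ** V i)" for i
    using inner_matrix_mult_right[of "V i ** Z" "conj_transpose (V i)" X]
      inner_matrix_mult_left[of "V i" Z "X ** V i"] by (simp add: matrix_mul_assoc)
  then show ?thesis
    by (simp add: kraus_def kraus_dual_def inner_sum_left inner_sum_right)
qed

lemma sum_matrix_vector: "sum F J *v (x :: complex^'n) = (\<Sum>i\<in>J. F i *v x)"
  by (induction J rule: infinite_finite_induct) (simp_all add: matrix_vector_mult_add_rdistrib)

text \<open>Reduces positivity to the forms at the vectors \<open>V i *v x\<close>; for
  \<open>X = mat 1\<close> it measures their total squared length.\<close>

lemma kraus_dual_form:
  "x \<bullet> (kraus_dual J V X *v x) = (\<Sum>i\<in>J. (V i *v x) \<bullet> (X *v (V i *v x)))"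
proof -
  have "x \<bullet> ((conj_transpose (V i) ** X ** V i) *v x) = (V i *v x) \<bullet> (X *v (V i *v x))" for i
    using inner_conj_transpose[of "conj_transpose (V i)" x "X *v (V i *v x)"]
    by (simp flip: matrix_vector_mul_assoc)
  then show ?thesis
    by (simp add: kraus_dual_def sum_matrix_vector inner_sum_right)
qed

lemma psd_kraus: "Z \<in> psd_cone \<Longrightarrow> kraus J V Z \<in> psd_cone"
  using kraus_dual_form[of _ J "\<lambda>i. conj_transpose (V i)" Z]
  by (simp add: kraus_dual_conv_kraus psd_cone_iff hermitian_kraus sum_nonneg)

section \<open>Iterates of a unital map and of its trace-preserving adjoint\<close>

locale unital_kraus =
  fixes J :: "'i set" and V :: "'i \<Rightarrow> complex^'n^'n"
  assumes unital: "(\<Sum>i\<in>J. conj_transpose (V i) ** V i) = mat 1"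
begin

abbreviation "\<Psi> \<equiv> kraus J V"
abbreviation "\<Phi> \<equiv> kraus_dual J V"

lemma kraus_dual_mat_1: "\<Phi> (mat 1) = mat 1"
  by (simp add: kraus_dual_def unital)

text \<open>By unitality the squared lengths of the \<open>V i *v x\<close> add up to that of
  \<open>x\<close>, so summing the bounds at these vectors gives the same bounds at
  \<open>x\<close>.\<close>

lemma form_bounds_kraus_dual:
  assumes "form_bounds a b X"
  shows "form_bounds a b (\<Phi> X)"
proof -
  have "(\<Sum>i\<in>J. (V i *v x) \<bullet> (V i *v x)) = x \<bullet> x" for x
    using kraus_dual_form[of x J V "mat 1"] by (simp add: kraus_dual_mat_1)
  then have *: "c * (x \<bullet> x) = (\<Sum>i\<in>J. c * ((V i *v x) \<bullet> (V i *v x)))" for c x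
    by (simp flip: sum_distrib_left)
  have "a * (x \<bullet> x) \<le> x \<bullet> (\<Phi> X *v x) \<and> x \<bullet> (\<Phi> X *v x) \<le> b * (x \<bullet> x)" for x
    unfolding kraus_dual_form *[of _ x]
    using assms by (simp add: form_bounds_def sum_mono)
  then show ?thesis
    by (simp add: form_bounds_def)
qed

lemma kraus_density: "Z \<in> density_matrices \<Longrightarrow> \<Psi> Z \<in> density_matrices"
  by (simp add: density_matrices_iff psd_kraus inner_kraus kraus_dual_mat_1)

lemma iterate_kraus_dual:
  shows "hermitian X \<Longrightarrow> hermitian ((\<Phi> ^^ t) X)"
    and "form_bounds a b X \<Longrightarrow> form_bounds a b ((\<Phi> ^^ t) X)"
    and "(\<Phi> ^^ t) (mat 1) = mat 1"
  by (induction t) (simp_all add: hermitian_kraus_dual form_bounds_kraus_dual kraus_dual_mat_1)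

lemma iterate_kraus:
  shows "hermitian Z \<Longrightarrow> hermitian ((\<Psi> ^^ t) Z)"
    and "Z \<in> density_matrices \<Longrightarrow> (\<Psi> ^^ t) Z \<in> density_matrices"
  by (induction t) (simp_all add: hermitian_kraus kraus_density)

lemma inner_iterate_kraus: "(\<Psi> ^^ t) Z \<bullet> X = Z \<bullet> (\<Phi> ^^ t) X"
  by (induction t arbitrary: X) (simp_all add: inner_kraus funpow_swap1[of \<Phi>])

lemma linear_iterate_kraus: "linear (\<Psi> ^^ t)" "linear (\<Phi> ^^ t)"
  by (simp_all add: linear_funpow linear_kraus linear_kraus_dual)

section \<open>From finite projective diameter to exponential decay\<close>

lemma iterate_kraus_dual_pd:
  assumes "X \<in> pd_cone"
  shows "(\<Phi> ^^ t) X \<in> pd_cone"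
proof -
  have X: "hermitian X" using assms by (simp add: pd_cone_def)
  have bounds: "form_bounds (lambda_min X) (lambda_max X) ((\<Phi> ^^ t) X)"
    using eigenvalue_bounds[OF X] by (intro iterate_kraus_dual) (simp add: form_bounds_def)
  have pos: "0 < lambda_min X"
    using assms eigenvalue_bounds(1)[OF X] by (rule pd_eigenvalue_pos)
  then have "0 < x \<bullet> ((\<Phi> ^^ t) X *v x)" if "x \<noteq> 0" for x
  proof -
    have "0 < lambda_min X * (x \<bullet> x)"
      using pos that by simp
    also have "\<dots> \<le> x \<bullet> ((\<Phi> ^^ t) X *v x)"
      using bounds by (simp add: form_bounds_def)
    finally show ?thesis .
  qed
  with X show ?thesis
    by (simp add: pd_cone_iff iterate_kraus_dual(1))
qed

text \<open>The Hilbert distance to \<open>(\<Phi> ^^ N) (mat 1) = mat 1\<close> is the logarithm of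
  the extreme eigenvalue ratio, so a finite diameter bounds that ratio on \<open>pd_cone\<close>.
  Perturbing by small multiples of the identity extends the comparison to
  \<open>psd_cone\<close>.\<close>

lemma finite_diameter_comparison:
  assumes "projective_diameter (\<Phi> ^^ N) < \<infinity>"
  obtains K where "1 < K"
    "\<And>X v w. X \<in> psd_cone \<Longrightarrow> norm v = 1 \<Longrightarrow> norm w = 1 \<Longrightarrow>
      v \<bullet> ((\<Phi> ^^ N) X *v v) \<le> K * (w \<bullet> ((\<Phi> ^^ N) X *v w))"
proof -
  obtain R where R: "projective_diameter (\<Phi> ^^ N) < ereal R"
    using assms less_PInf_Ex_of_nat[of "projective_diameter (\<Phi> ^^ N)"] by auto
  \<comment> \<open>The summand 1 makes \<open>K\<close> strictly larger than 1, so the contraction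
    factor built from it will be positive.\<close>
  define K where "K = 1 + exp R"
  have dist: "hilbert_dist ((\<Phi> ^^ N) X) (mat 1) \<le> R" if "X \<in> pd_cone" for X
  proof -
    have "ereal (hilbert_dist ((\<Phi> ^^ N) X) ((\<Phi> ^^ N) (mat 1))) \<le> projective_diameter (\<Phi> ^^ N)"
      unfolding projective_diameter_def
      using that by (intro SUP_upper2[of "(X, mat 1)"]) simp_all
    also note R
    finally show ?thesis
      by (simp add: iterate_kraus_dual(3))
  qed
  have pd: "v \<bullet> ((\<Phi> ^^ N) X *v v) \<le> K * (w \<bullet> ((\<Phi> ^^ N) X *v w))"
    if X: "X \<in> pd_cone" and "norm v = 1" "norm w = 1" for X v w
  proof -
    let ?A = "(\<Phi> ^^ N) X"
    have A: "?A \<in> pd_cone" "hermitian ?A"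
      using iterate_kraus_dual_pd[OF X] by (simp_all add: pd_cone_def)
    note eig = eigenvalue_bounds[OF A(2)]
    have pos: "0 < lambda_min ?A" "0 < lambda_max ?A"
      using pd_eigenvalue_pos[OF A(1)] eig(1,2) by blast+
    have "lambda_max ?A / lambda_min ?A \<le> exp R"
      using dist[OF X] pos by (subst ln_le_cancel_iff[symmetric]) (simp_all add: hilbert_dist_mat_1)
    then have "lambda_max ?A \<le> exp R * lambda_min ?A"
      using pos by (simp add: field_simps)
    also have "\<dots> \<le> K * lambda_min ?A"
      using pos by (simp add: K_def)
    also have "\<dots> \<le> K * (w \<bullet> (?A *v w))"
      using eig(3)[of w] that(3) by (intro mult_left_mono) (simp_all add: K_def dot_square_norm add_nonneg_nonneg)
    finally show ?thesis
      using eig(4)[of v] that(2) by (simp add: dot_square_norm)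
  qed
  have "v \<bullet> ((\<Phi> ^^ N) X *v v) \<le> K * (w \<bullet> ((\<Phi> ^^ N) X *v w))"
    if X: "X \<in> psd_cone" and vw: "norm v = 1" "norm w = 1" for X v w
  proof (rule field_le_epsilon)
    fix e :: real
    assume "e > 0"
    \<comment> \<open>Shifting by \<open>d\<close> adds exactly \<open>K * d = e\<close> to the
      right side.\<close>
    define d where "d = e / K"
    have "d > 0" "K > 0" using \<open>e > 0\<close> by (simp_all add: d_def K_def add_pos_pos)
    let ?Y = "X + d *\<^sub>R mat 1"
    have "?Y \<in> pd_cone"
      using X \<open>d > 0\<close> by (auto simp: psd_cone_iff pd_cone_iff matrix_vector_mult_add_rdistrib
          matrix_vector_mult_scaleR_left inner_add add_nonneg_pos)
    moreover have "(\<Phi> ^^ N) ?Y = (\<Phi> ^^ N) X + d *\<^sub>R mat 1"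
      by (simp add: linear_add[OF linear_iterate_kraus(2)] linear_scale[OF linear_iterate_kraus(2)]
          iterate_kraus_dual(3))
    ultimately have "v \<bullet> ((\<Phi> ^^ N) X *v v) + d \<le> K * (w \<bullet> ((\<Phi> ^^ N) X *v w) + d)"
      using pd[of ?Y, OF _ vw] vw by (simp add: matrix_vector_mult_add_rdistrib
          matrix_vector_mult_scaleR_left inner_add dot_square_norm)
    moreover have "K * d = e" using \<open>K > 0\<close> by (simp add: d_def)
    ultimately show "v \<bullet> ((\<Phi> ^^ N) X *v v) \<le> K * (w \<bullet> ((\<Phi> ^^ N) X *v w)) + e"
      using \<open>d > 0\<close> by (simp add: distrib_left)
  qed
  then show ?thesis using that[of K] by (simp add: K_def)
qed

text \<open>Each block of \<open>N\<close> steps contracts the enclosure by a fixed factor, and the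
  remaining \<open>t mod N\<close> steps do not widen it.\<close>

lemma iterate_kraus_dual_near_scalar:
  assumes "N > 0" and "projective_diameter (\<Phi> ^^ N) < \<infinity>"
  obtains C \<rho> :: real where "C > 0" "0 < \<rho>" "\<rho> < 1"
    "\<And>X t. hermitian X \<Longrightarrow> \<exists>a. norm ((\<Phi> ^^ t) X - a *\<^sub>R mat 1) \<le> C * \<rho> ^ t * norm X"
proof -
  obtain K where K: "1 < K" and comparison: "\<And>X v w. X \<in> psd_cone \<Longrightarrow> norm v = 1 \<Longrightarrow>
      norm w = 1 \<Longrightarrow> v \<bullet> ((\<Phi> ^^ N) X *v v) \<le> K * (w \<bullet> ((\<Phi> ^^ N) X *v w))"
    using finite_diameter_comparison[OF assms(2)] by blast
  define k where "k = (K - 1) / (K + 1)"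
  have k: "0 < k" "k < 1" using K by (simp_all add: k_def)
  have power_N: "\<exists>a' b'. form_bounds a' b' ((\<Phi> ^^ (N * q)) X) \<and> b' - a' \<le> k ^ q * (b - a)"
    if X: "hermitian X" "form_bounds a b X" for X a b q
  proof (induction q)
    case 0
    then show ?case using X(2) by auto
  next
    case (Suc q)
    then obtain a' b' where ab: "form_bounds a' b' ((\<Phi> ^^ (N * q)) X)" "b' - a' \<le> k ^ q * (b - a)"
      by blast
    obtain a'' b'' where "form_bounds a'' b'' ((\<Phi> ^^ N) ((\<Phi> ^^ (N * q)) X))"
      and "b'' - a'' \<le> k * (b' - a')"
      using oscillation_contraction[OF linear_iterate_kraus(2) iterate_kraus_dual(3)
          iterate_kraus_dual(1) less_imp_le[OF K] comparison iterate_kraus_dual(1)[OF X(1)] ab(1)]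
      unfolding k_def by blast
    moreover have "k * (b' - a') \<le> k ^ Suc q * (b - a)"
      using mult_left_mono[OF ab(2), of k] k(1) by (simp add: mult.assoc)
    ultimately have "form_bounds a'' b'' ((\<Phi> ^^ (N * Suc q)) X)" "b'' - a'' \<le> k ^ Suc q * (b - a)"
      by (simp_all add: funpow_add)
    then show ?case by blast
  qed
  \<comment> \<open>Spreads the factor \<open>k\<close> per block evenly over its \<open>N\<close>
    steps.\<close>
  define \<rho> where "\<rho> = root N k"
  have \<rho>: "0 < \<rho>" "\<rho> < 1" "\<rho> ^ N = k"
    using k \<open>N > 0\<close> by (simp_all add: \<rho>_def)
  \<comment> \<open>The division by \<open>k\<close> pays for rounding \<open>t / N\<close> down,
    which loses less than one block.\<close>
  have power_le: "k ^ (t div N) \<le> \<rho> ^ t / k" for t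
  proof -
    have "k ^ (t div N) * k = \<rho> ^ (N * (t div N) + N)"
      by (simp add: power_add power_mult \<rho>(3))
    also have "\<dots> \<le> \<rho> ^ t"
      using \<rho> \<open>N > 0\<close> dividend_less_times_div[of N t] by (intro power_decreasing) auto
    finally show ?thesis using k by (simp add: field_simps)
  qed
  define m where "m = (real CARD('n))\<^sup>2"
  have m: "0 < m" by (simp add: m_def)
  \<comment> \<open>One factor \<open>2 * m\<close> comes from the width of the initial enclosure,
    the other from converting width to norm, and \<open>1 / k\<close> from the rounding.\<close>
  have "\<exists>a. norm ((\<Phi> ^^ t) X - a *\<^sub>R mat 1) \<le> (4 * m\<^sup>2 / k) * \<rho> ^ t * norm X"
    if X: "hermitian X" for X t
  proof -
    obtain a b where ab: "form_bounds a b ((\<Phi> ^^ (N * (t div N))) X)"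
        "b - a \<le> k ^ (t div N) * (2 * m * norm X)"
      using power_N[OF X form_bounds_norm[of X], of "t div N"]
      by (auto simp: m_def ac_simps)
    have "form_bounds a b ((\<Phi> ^^ (t mod N)) ((\<Phi> ^^ (N * (t div N))) X))"
      using ab(1) by (rule iterate_kraus_dual)
    also have "(\<Phi> ^^ (t mod N)) ((\<Phi> ^^ (N * (t div N))) X) = (\<Phi> ^^ (t mod N + N * (t div N))) X"
      by (simp only: funpow_add o_apply)
    also have "t mod N + N * (t div N) = t"
      by simp
    finally have "norm ((\<Phi> ^^ t) X - a *\<^sub>R mat 1) \<le> 2 * m * (b - a)"
      unfolding m_def by (rule form_bounds_norm_diff_scalar[OF iterate_kraus_dual(1)[OF X]])
    also have "\<dots> \<le> 2 * m * (\<rho> ^ t / k * (2 * m * norm X))"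
      using m by (intro mult_left_mono order_trans[OF ab(2)] mult_right_mono power_le) auto
    finally show ?thesis
      by (auto simp: power2_eq_square ac_simps)
  qed
  then show ?thesis
    using that[of "4 * m\<^sup>2 / k" \<rho>] \<rho> k m by simp
qed

text \<open>Iterating \<open>\<Psi>\<close> on a traceless \<open>D\<close> and pairing with \<open>\<Psi>\<^sup>t D\<close> itself transfers the
  estimate from \<open>\<Phi>\<close> to \<open>\<Psi>\<close>, as scalar matrices are orthogonal to \<open>D\<close>.\<close>

lemma iterate_kraus_traceless:
  assumes near_scalar: "\<And>X. hermitian X \<Longrightarrow> \<exists>a. norm ((\<Phi> ^^ t) X - a *\<^sub>R mat 1) \<le> c * norm X"
    and D: "hermitian D" "D \<bullet> mat 1 = 0"
  shows "norm ((\<Psi> ^^ t) D) \<le> c * norm D"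
proof (cases "(\<Psi> ^^ t) D = 0")
  \<comment> \<open>The general argument divides by \<open>norm ((\<Psi> ^^ t) D)\<close>. Here only
    \<open>0 \<le> c\<close> is at stake, and the hypothesis at the identity gives it.\<close>
  case True
  obtain a where "norm ((\<Phi> ^^ t) (mat 1) - a *\<^sub>R mat 1) \<le> c * norm (mat 1 :: complex^'n^'n)"
    using near_scalar[of "mat 1"] by auto
  then have "0 \<le> c * norm (mat 1 :: complex^'n^'n)"
    using norm_ge_zero order_trans by blast
  moreover have "(mat 1 :: complex^'n^'n) \<noteq> 0"
    by (simp add: vec_eq_iff mat_def)
  ultimately have "0 \<le> c"
    by (simp add: zero_le_mult_iff)
  with True show ?thesis by simp
next
  case False
  let ?E = "(\<Psi> ^^ t) D"
  obtain a where a: "norm ((\<Phi> ^^ t) ?E - a *\<^sub>R mat 1) \<le> c * norm ?E"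
    using near_scalar iterate_kraus(1)[OF D(1)] by blast
  have "norm ?E * norm ?E = ?E \<bullet> ?E"
    by (simp add: dot_square_norm power2_eq_square)
  also have "\<dots> = D \<bullet> (\<Phi> ^^ t) ?E"
    by (rule inner_iterate_kraus)
  also have "\<dots> = D \<bullet> ((\<Phi> ^^ t) ?E - a *\<^sub>R mat 1)"
    using D(2) by (simp add: inner_diff)
  also have "\<dots> \<le> norm D * (c * norm ?E)"
    by (rule order_trans[OF norm_cauchy_schwarz]) (intro mult_left_mono a norm_ge_zero)
  finally have "norm ?E * norm ?E \<le> (c * norm D) * norm ?E"
    by (simp add: ac_simps)
  with False show ?thesis by simp
qed

section \<open>The fixed point and the scalar limit\<close>

lemma kraus_fixed_point_exists:
  assumes decay: "\<And>D t. hermitian D \<Longrightarrow> D \<bullet> mat 1 = 0 \<Longrightarrow> norm ((\<Psi> ^^ t) D) \<le> C * \<rho> ^ t * norm D"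
    and \<rho>: "0 < \<rho>" "\<rho> < 1"
  obtains Z where "Z \<in> density_matrices" "\<Psi> Z = Z"
proof -
  \<comment> \<open>The orbit starts at the identity normalised to trace 1.\<close>
  define S where "S t = (\<Psi> ^^ t) ((1 / CARD('n)) *\<^sub>R mat 1)" for t
  have density: "S t \<in> density_matrices" for t
    unfolding S_def
  proof (rule iterate_kraus(2))
    have "(mat 1 :: complex^'n^'n) \<bullet> mat 1 = CARD('n)"
      by (simp add: inner_mat_1 trace_I)
    then show "(1 / CARD('n)) *\<^sub>R mat 1 \<in> (density_matrices :: (complex^'n^'n) set)"
      by (simp add: density_matrices_iff psd_cone_iff matrix_vector_mult_scaleR_left)
  qed
  let ?D = "S 1 - S 0"
  have D: "hermitian ?D" "?D \<bullet> mat 1 = 0"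
    using density[of 0] density[of 1] by (simp_all add: density_matrices_iff psd_cone_iff inner_diff)
  \<comment> \<open>The increments are iterates of one traceless matrix, hence dominated by a
    geometric series; their sums telescope, so \<open>S\<close> converges.\<close>
  have "S (Suc t) - S t = (\<Psi> ^^ t) ?D" for t
    unfolding linear_diff[OF linear_iterate_kraus(1)] S_def
    by (simp add: funpow_swap1)
  then have "norm (S (Suc t) - S t) \<le> C * \<rho> ^ t * norm ?D" for t
    using decay[OF D, of t] by (simp only:)
  moreover have "summable (\<lambda>t. C * \<rho> ^ t * norm ?D)"
    using \<rho> by (intro summable_mult summable_mult2 summable_geometric) simp
  ultimately have "summable (\<lambda>t. S (Suc t) - S t)"
    by (rule summable_comparison_test'[of "\<lambda>t. C * \<rho> ^ t * norm ?D" 0, rotated])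
  then have "convergent (\<lambda>t. \<Sum>i<t. S (Suc i) - S i)"
    by (simp add: summable_iff_convergent)
  then have "convergent S"
    using convergent_diff_const_right_iff[of S "S 0"] by (simp add: sum_lessThan_telescope)
  then obtain Z where Z: "S \<longlonglongrightarrow> Z" by (auto simp: convergent_def)
  have "Z \<in> density_matrices"
    using closed_sequentially[OF closed_density_matrices density Z] .
  moreover have "(\<lambda>t. \<Psi> (S t)) \<longlonglongrightarrow> \<Psi> Z"
    using bounded_linear.tendsto[OF linear_kraus[unfolded linear_conv_bounded_linear] Z] .
  then have "(\<lambda>t. S (Suc t)) \<longlonglongrightarrow> \<Psi> Z"
    by (simp add: S_def)
  then have "\<Psi> Z = Z"
    using LIMSEQ_Suc[OF Z] LIMSEQ_unique by blast
  ultimately show ?thesis using that by blast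
qed

text \<open>Pairing with the fixed point \<open>Z\<close> is invariant under \<open>\<Phi>\<close>.
  Removing the expected limit from \<open>X\<close> leaves \<open>Y\<close> with zero pairing, which
  forces the scalar near \<open>(\<Phi> ^^ t) Y\<close> to be small.\<close>

lemma iterate_kraus_dual_to_trace:
  assumes near_scalar: "\<And>X. hermitian X \<Longrightarrow> \<exists>a. norm ((\<Phi> ^^ t) X - a *\<^sub>R mat 1) \<le> c * norm X"
    and Z: "Z \<bullet> mat 1 = 1" "\<Psi> Z = Z" and X: "hermitian X"
  shows "norm ((\<Phi> ^^ t) X - (Z \<bullet> X) *\<^sub>R mat 1)
    \<le> (1 + norm Z * norm (mat 1 :: complex^'n^'n)) * c * norm (X - (Z \<bullet> X) *\<^sub>R mat 1)"
proof -
  define Y where "Y = X - (Z \<bullet> X) *\<^sub>R mat 1"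
  have "(\<Psi> ^^ t) Z = Z"
    using Z(2) by (induction t) simp_all
  then have ZY: "Z \<bullet> (\<Phi> ^^ t) Y = 0"
    using Z(1) inner_iterate_kraus[of t Z Y] by (simp add: Y_def inner_diff)
  have Y: "(\<Phi> ^^ t) Y = (\<Phi> ^^ t) X - (Z \<bullet> X) *\<^sub>R mat 1"
    by (simp add: Y_def linear_diff[OF linear_iterate_kraus(2)] linear_scale[OF linear_iterate_kraus(2)]
        iterate_kraus_dual(3))
  obtain a where a: "norm ((\<Phi> ^^ t) Y - a *\<^sub>R mat 1) \<le> c * norm Y"
    using near_scalar[of Y] X by (auto simp: Y_def)
  \<comment> \<open>Pairing the error with \<open>Z\<close> isolates \<open>- a\<close>, because
    \<open>Z\<close> has trace 1.\<close>
  have "\<bar>a\<bar> = \<bar>Z \<bullet> ((\<Phi> ^^ t) Y - a *\<^sub>R mat 1)\<bar>"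
    using ZY Z(1) by (simp add: inner_diff)
  also have "\<dots> \<le> norm Z * (c * norm Y)"
    by (rule order_trans[OF Cauchy_Schwarz_ineq2]) (intro mult_left_mono a norm_ge_zero)
  finally have "norm (a *\<^sub>R (mat 1 :: complex^'n^'n)) \<le> norm Z * (c * norm Y) * norm (mat 1 :: complex^'n^'n)"
    by (simp add: mult_right_mono)
  then have "norm ((\<Phi> ^^ t) Y) \<le> c * norm Y + norm Z * (c * norm Y) * norm (mat 1 :: complex^'n^'n)"
    using norm_triangle_sub[of "(\<Phi> ^^ t) Y" "a *\<^sub>R mat 1"] a by linarith
  then show ?thesis
    unfolding Y[symmetric] Y_def[symmetric] by (simp add: algebra_simps)
qed

end

section \<open>Convergence of arbitrary orbits\<close>

lemma funpow_of_recursion: "(\<And>t. z (Suc t) = f (z t)) \<Longrightarrow> z t = (f ^^ t) (z 0)"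
  by (induction t) simp_all

lemma LIMSEQ_geometric_bound:
  fixes z :: "nat \<Rightarrow> 'a::real_normed_vector"
  assumes "\<And>t. norm (z t - l) \<le> C * \<rho> ^ t * d" "0 < \<rho>" "\<rho> < (1 :: real)"
  shows "z \<longlonglongrightarrow> l"
proof -
  have "(\<lambda>t. C * \<rho> ^ t * d) \<longlonglongrightarrow> C * 0 * d"
    using assms(2,3) by (intro tendsto_intros LIMSEQ_realpow_zero) auto
  then have "(\<lambda>t. z t - l) \<longlonglongrightarrow> 0"
    using Lim_null_comparison[of "\<lambda>t. z t - l" "\<lambda>t. C * \<rho> ^ t * d"] assms(1) by simp
  then show ?thesis by (simp add: LIM_zero_iff)
qed

theorem theorem4:
  fixes J :: "'i set" and V :: "'i \<Rightarrow> complex^'n^'n" and N :: nat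
  assumes "finite J"
    and "(\<Sum>i\<in>J. conj_transpose (V i) ** V i) = mat 1"
    and "N > 0"
    and "projective_diameter (kraus_dual J V ^^ N) < \<infinity>"
  shows "(\<exists>!Zbar. Zbar \<in> density_matrices \<and> kraus J V Zbar = Zbar) \<and>
    (\<forall>Zbar. Zbar \<in> density_matrices \<and> kraus J V Zbar = Zbar \<longrightarrow>
      (\<forall>Z :: nat \<Rightarrow> complex^'n^'n.
         Z 0 \<in> density_matrices \<and> (\<forall>t. Z (Suc t) = kraus J V (Z t)) \<longrightarrow> Z \<longlonglongrightarrow> Zbar) \<and>
      (\<forall>X :: nat \<Rightarrow> complex^'n^'n.
         hermitian (X 0) \<and> (\<forall>t. X (Suc t) = kraus_dual J V (X t)) \<longrightarrow>
           X \<longlonglongrightarrow> mat (trace (Zbar ** X 0))) \<and>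
      (\<exists>C \<rho> :: real. C > 0 \<and> 0 < \<rho> \<and> \<rho> < 1 \<and>
        (\<forall>Z :: nat \<Rightarrow> complex^'n^'n.
           Z 0 \<in> density_matrices \<and> (\<forall>t. Z (Suc t) = kraus J V (Z t)) \<longrightarrow>
             (\<forall>t. norm (Z t - Zbar) \<le> C * \<rho> ^ t * norm (Z 0 - Zbar))) \<and>
        (\<forall>X :: nat \<Rightarrow> complex^'n^'n.
           hermitian (X 0) \<and> (\<forall>t. X (Suc t) = kraus_dual J V (X t)) \<longrightarrow>
             (\<forall>t. norm (X t - mat (trace (Zbar ** X 0)))
                    \<le> C * \<rho> ^ t * norm (X 0 - mat (trace (Zbar ** X 0)))))))"
    (is "?unique \<and> (\<forall>Zbar. ?fix Zbar \<longrightarrow> ?state Zbar \<and> ?obs Zbar \<and> ?rate Zbar)")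
proof -
  interpret unital_kraus J V
    using assms(2) by unfold_locales
  obtain C \<rho> where C: "C > 0" and \<rho>: "0 < \<rho>" "\<rho> < 1" and near_scalar:
    "\<And>X t. hermitian X \<Longrightarrow> \<exists>a. norm ((\<Phi> ^^ t) X - a *\<^sub>R mat 1) \<le> C * \<rho> ^ t * norm X"
    using iterate_kraus_dual_near_scalar[OF assms(3,4)] by blast
  have decay: "norm ((\<Psi> ^^ t) D) \<le> C * \<rho> ^ t * norm D" if "hermitian D" "D \<bullet> mat 1 = 0" for D t
    using near_scalar that by (rule iterate_kraus_traceless)
  have state: "norm (Z t - Zbar) \<le> C * \<rho> ^ t * norm (Z 0 - Zbar)"
    if "?fix Zbar" and Z: "Z 0 \<in> density_matrices" "\<And>t. Z (Suc t) = \<Psi> (Z t)" for Zbar Z t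
  proof -
    have "(\<Psi> ^^ t) Zbar = Zbar"
      using that(1) by (induction t) simp_all
    \<comment> \<open>Both matrices have trace 1, so their difference is traceless and the decay
      estimate applies.\<close>
    then have "Z t - Zbar = (\<Psi> ^^ t) (Z 0 - Zbar)"
      by (simp add: linear_diff[OF linear_iterate_kraus(1)] funpow_of_recursion[of Z \<Psi> t, OF Z(2)])
    then show ?thesis
      using decay[of "Z 0 - Zbar" t] that(1) Z(1)
      by (simp add: density_matrices_iff psd_cone_iff inner_diff)
  qed
  have state_lim: "Z \<longlonglongrightarrow> Zbar"
    if "?fix Zbar" "Z 0 \<in> density_matrices" "\<And>t. Z (Suc t) = \<Psi> (Z t)" for Zbar Z
    using LIMSEQ_geometric_bound[OF state[OF that] \<rho>] .
  have unique: ?unique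
  proof -
    obtain Z where Z: "?fix Z"
      using kraus_fixed_point_exists[OF decay \<rho>] by blast
    have "Z' = Z" if "?fix Z'" for Z'
      \<comment> \<open>A second fixed point is a constant orbit, which must converge to
        \<open>Z\<close>.\<close>
      using state_lim[OF Z, of "\<lambda>_. Z'"] that by (simp add: tendsto_const_iff)
    with Z show ?thesis by blast
  qed
  have "?state Zbar \<and> ?obs Zbar \<and> ?rate Zbar" if Zbar: "?fix Zbar" for Zbar
  proof -
    \<comment> \<open>The constant from the scalar limit estimate dominates \<open>C\<close>, so one
      constant serves both evolutions.\<close>
    define C' where "C' = (1 + norm Zbar * norm (mat 1 :: complex^'n^'n)) * C"
    have "C \<le> C'"
      using C by (simp add: C'_def)
    have obs: "norm (X t - mat (trace (Zbar ** X 0)))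
        \<le> C' * \<rho> ^ t * norm (X 0 - mat (trace (Zbar ** X 0)))"
      if X: "hermitian (X 0)" "\<And>t. X (Suc t) = \<Phi> (X t)" for X t
    proof -
      \<comment> \<open>The trace is real for Hermitian factors, so the limit is a real multiple of
        the identity.\<close>
      have "mat (trace (Zbar ** X 0)) = (Zbar \<bullet> X 0) *\<^sub>R (mat 1 :: complex^'n^'n)"
        using Zbar X(1)
        by (simp add: density_matrices_iff psd_cone_iff hermitian_trace_mult mat_of_real)
      then show ?thesis
        using iterate_kraus_dual_to_trace[of t "C * \<rho> ^ t" Zbar "X 0", OF near_scalar _ _ X(1)] Zbar
          funpow_of_recursion[of X \<Phi> t, OF X(2)]
        by (simp add: C'_def density_matrices_iff mult.assoc)
    qed
    have state': "norm (Z t - Zbar) \<le> C' * \<rho> ^ t * norm (Z 0 - Zbar)"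
      if "Z 0 \<in> density_matrices" "\<And>t. Z (Suc t) = \<Psi> (Z t)" for Z t
      using \<rho> \<open>C \<le> C'\<close> by (intro order_trans[OF state[OF Zbar that]] mult_right_mono) auto
    have "?state Zbar"
      using state_lim[OF Zbar] by blast
    moreover have "?obs Zbar"
      using LIMSEQ_geometric_bound[OF obs \<rho>] by blast
    moreover have "?rate Zbar"
    proof (intro exI conjI)
      show "C' > 0" using C \<open>C \<le> C'\<close> by linarith
    qed (use \<rho> state' obs in blast)+
    ultimately show ?thesis by blast
  qed
  with unique show ?thesis by blast
qed

end
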